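(* Let $V$ be a maximal isotropic subspace of $\mathbb{C}^n$ and let $p\in\mathbb{C}^n$ be a non-zero element. Then the set $$\mathcal{E}_V(p)=\{\phi_a:\mathbf{SO}(n)\to\mathbb{C}\mid \phi_a(x)=\operatorname{trace}(p^t a x^t),\ a\in V\}$$ of complex valued functions is an eigenfamily on $\mathbf{SO}(n)$.
   Context: $\mathbf{SO}(n)=\{x\in\mathbf{GL}_n(\mathbb{R})\mid x x^t=I_n,\ \det x=1\}$ carries the left-invariant Riemannian metric induced by the scalar product $g(Z,W)=\operatorname{Re}\operatorname{trace}(ZW^* )$ on its Lie algebra $\mathfrak{so}(n)$ of real skew-symmetric $n\times n$ matrices. Elements of $\mathbb{C}^n$ are row vectors, so $p^t a$ is an $n\times n$ complex matrix. Isotropic refers to the complex bilinear form $(a,b)=\sum_{k=1}^n a_k b_k$ on $\mathbb{C}^n$: a subspace $V$ is isotropic if $(a,b)=0$ for all $a,b\in V$, and it is maximal isotropic if it is maximal with this property. For complex valued functions $\phi,\psi$ on a semi-Riemannian manifold $(M,g)$, $\tau(\phi)$ is the Laplacian ($\operatorname{div}\operatorname{grad}$) extended complex linearly and $\kappa(\phi,\psi)=g(\operatorname{grad}(\phi),\operatorname{grad}(\psi))$ with $g$ extended complex bilinearly. On $\mathbf{SO}(n)$ these are $\tau(\phi)=\sum_{Z\in\mathcal{B}}Z^2(\phi)$ and $\kappa(\phi,\psi)=\sum_{Z\in\mathcal{B}}Z(\phi)Z(\psi)$ for any orthonormal basis $\mathcal{B}$ of the Lie algebra of left-invariant vector fields.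 A set $\mathcal{E}$ of complex valued functions on $M$ is an eigenfamily if there exist $\lambda,\mu\in\mathbb{C}$ such that $\tau(\phi)=\lambda\phi$ and $\kappa(\phi,\psi)=\mu\,\phi\psi$ for all $\phi,\psi\in\mathcal{E}$. *)

theory Defs
  imports "HOL-Analysis.Analysis"
begin

definition SO :: "(real^'n^'n) set" where
  "SO = {x. x ** transpose x = mat 1 \<and> det x = 1}"

definition so :: "(real^'n^'n) set" where
  "so = {Z. transpose Z = - Z}"

text \<open>The conjugate transpose in \<open>Re trace (Z W\<^sup>*)\<close> is the transpose, since the
  elements of \<open>so\<close> are real matrices.\<close>

definition so_metric :: "real^'n^'n \<Rightarrow> real^'n^'n \<Rightarrow> real" where
  "so_metric Z W = trace (Z ** transpose W)"

definition so_orthonormal_basis :: "(real^'n^'n) set \<Rightarrow> bool" where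
  "so_orthonormal_basis B \<longleftrightarrow>
     B \<subseteq> so \<and> span B = so \<and>
     (\<forall>Z\<in>B. so_metric Z Z = 1) \<and> pairwise (\<lambda>Z W. so_metric Z W = 0) B"

text \<open>The operations \<open>*\<close>, \<open>^\<close> of type \<open>real^'n^'n\<close> are entrywise, hence the iterated
  \<open>**\<close> for the powers of a matrix.\<close>

definition mat_exp :: "real^'n^'n \<Rightarrow> real^'n^'n" where
  "mat_exp A = (\<Sum>k. (1 / fact k) *\<^sub>R ((\<lambda>M. A ** M) ^^ k) (mat 1))"

text \<open>A function on \<open>SO\<close> is represented by a function on all matrices, of which only the
  values on \<open>SO\<close> matter: for \<open>x \<in> SO\<close> and \<open>Z \<in> so\<close> the curve \<open>t \<mapsto> x exp(tZ)\<close> stays in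
  \<open>SO\<close>. It is the integral curve through \<open>x\<close> of the left-invariant vector field with value
  \<open>Z\<close> at the identity, so \<open>lie_deriv Z \<phi>\<close> is the function \<open>Z(\<phi>)\<close>.\<close>

definition lie_deriv ::
    "real^'n^'n \<Rightarrow> (real^'n^'n \<Rightarrow> complex) \<Rightarrow> real^'n^'n \<Rightarrow> complex" where
  "lie_deriv Z \<phi> x = vector_derivative (\<lambda>t. \<phi> (x ** mat_exp (t *\<^sub>R Z))) (at 0)"

text \<open>\<open>SO_Ck k \<phi>\<close>: the iterated derivatives of \<open>\<phi>\<close> along left-invariant vector fields exist and
  are continuous up to order \<open>k\<close>. As these fields span every tangent space,
  this says that \<open>\<phi>\<close> is of class \<open>C\<^sup>k\<close> on \<open>SO\<close>.\<close>

primrec SO_Ck :: "nat \<Rightarrow> (real^'n^'n \<Rightarrow> complex) \<Rightarrow> bool" where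
  "SO_Ck 0 \<phi> \<longleftrightarrow> continuous_on SO \<phi>"
| "SO_Ck (Suc k) \<phi> \<longleftrightarrow>
     continuous_on SO \<phi> \<and>
     (\<forall>Z\<in>so. (\<forall>x\<in>SO. (\<lambda>t::real. \<phi> (x ** mat_exp (t *\<^sub>R Z))) differentiable (at 0)) \<and>
              SO_Ck k (lie_deriv Z \<phi>))"

definition SO_smooth :: "(real^'n^'n \<Rightarrow> complex) \<Rightarrow> bool" where
  "SO_smooth \<phi> \<longleftrightarrow> (\<forall>k. SO_Ck k \<phi>)"

definition tau :: "(real^'n^'n) set \<Rightarrow> (real^'n^'n \<Rightarrow> complex) \<Rightarrow> real^'n^'n \<Rightarrow> complex" where
  "tau B \<phi> x = (\<Sum>Z\<in>B. lie_deriv Z (lie_deriv Z \<phi>) x)"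

definition kappa ::
    "(real^'n^'n) set \<Rightarrow> (real^'n^'n \<Rightarrow> complex) \<Rightarrow> (real^'n^'n \<Rightarrow> complex) \<Rightarrow>
     real^'n^'n \<Rightarrow> complex" where
  "kappa B \<phi> \<psi> x = (\<Sum>Z\<in>B. lie_deriv Z \<phi> x * lie_deriv Z \<psi> x)"

text \<open>\<open>tau\<close> and \<open>kappa\<close> do not depend on the orthonormal basis; the equations are required for
  all of them, with the same constants \<open>lam\<close>, \<open>mu\<close>. An orthonormal basis exists by
  \<open>so_orthonormal_basis_exists\<close> below.\<close>

definition SO_eigenfamily :: "(real^'n^'n \<Rightarrow> complex) set \<Rightarrow> bool" where
  "SO_eigenfamily E \<longleftrightarrow>
     (\<forall>\<phi>\<in>E. SO_smooth \<phi>) \<and>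
     (\<exists>lam mu. \<forall>B. so_orthonormal_basis B \<longrightarrow>
        (\<forall>\<phi>\<in>E. \<forall>\<psi>\<in>E. \<forall>x\<in>SO.
           tau B \<phi> x = lam * \<phi> x \<and> kappa B \<phi> \<psi> x = mu * \<phi> x * \<psi> x))"

definition cbilin :: "complex^'n \<Rightarrow> complex^'n \<Rightarrow> complex" where
  "cbilin a b = (\<Sum>k\<in>UNIV. a $ k * b $ k)"

definition isotropic :: "(complex^'n) set \<Rightarrow> bool" where
  "isotropic V \<longleftrightarrow> vec.subspace V \<and> (\<forall>a\<in>V. \<forall>b\<in>V. cbilin a b = 0)"

definition maximal_isotropic :: "(complex^'n) set \<Rightarrow> bool" where
  "maximal_isotropic V \<longleftrightarrow> isotropic V \<and> (\<forall>W. isotropic W \<and> V \<subseteq> W \<longrightarrow> W = V)"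

text \<open>The row vectors \<open>p\<close>, \<open>a\<close> are \<open>1 \<times> n\<close> matrices, so \<open>p\<^sup>t a\<close> is the product of the column
  \<open>p\<close> and the row \<open>a\<close>.\<close>

definition phi :: "complex^'n \<Rightarrow> complex^'n \<Rightarrow> real^'n^'n \<Rightarrow> complex" where
  "phi p a x =
     trace ((columnvector p :: complex^1^'n) ** (rowvector a :: complex^'n^1)
            ** transpose (map_matrix complex_of_real x))"

definition eigenfamily_set :: "(complex^'n) set \<Rightarrow> complex^'n \<Rightarrow> (real^'n^'n \<Rightarrow> complex) set" where
  "eigenfamily_set V p = {phi p a | a. a \<in> V}"

lemma so_metric_eq_inner: "so_metric Z W = Z \<bullet> W"
  by (simp add: so_metric_def trace_def matrix_matrix_mult_def transpose_def inner_vec_def)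

lemma subspace_so: "subspace (so :: (real^'n^'n) set)"
proof -
  have "transpose (x + y) = transpose x + transpose y"
    "transpose (c *\<^sub>R x) = c *\<^sub>R transpose x" for x y :: "real^'n^'n" and c
    by (simp_all add: vec_eq_iff transpose_def)
  moreover have "transpose (0 :: real^'n^'n) = 0"
    by (simp add: vec_eq_iff transpose_def)
  ultimately show ?thesis by (simp add: subspace_def so_def)
qed

lemma so_orthonormal_basis_exists: "\<exists>B :: (real^'n^'n) set. so_orthonormal_basis B"
proof (rule orthonormal_basis_subspace[OF subspace_so])
  fix B :: "(real^'n^'n) set"
  assume B: "B \<subseteq> so" "pairwise orthogonal B" "\<And>x. x \<in> B \<Longrightarrow> norm x = 1" "span B = so"
  have "so_orthonormal_basis B"
    unfolding so_orthonormal_basis_def so_metric_eq_inner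
  proof (intro conjI ballI)
    show "B \<subseteq> so" "span B = so" by (fact B)+
    show "Z \<bullet> Z = 1" if "Z \<in> B" for Z
      using B(3)[OF that] by (simp add: norm_eq_1)
    show "pairwise (\<lambda>Z W. Z \<bullet> W = 0) B"
      using B(2) by (simp add: pairwise_def orthogonal_def)
  qed
  then show ?thesis by (rule exI)
qed

end

theory Submission
  imports Defs
begin

text \<open>Each \<open>\<phi>\<^sub>a\<close> is the restriction of the linear function \<open>x \<mapsto> p x a\<^sup>t\<close>, so differentiation along
  \<open>Z\<close> is right multiplication of the argument by \<open>Z\<close>; in particular the iterated derivatives are
  again linear. Expanding the skew-symmetric part of a matrix in an orthonormal basis \<open>B\<close> of
  \<open>so(n)\<close> gives \<open>\<Sum>\<^sub>Z Z\<^sub>i\<^sub>j Z\<^sub>k\<^sub>l = (\<delta>\<^sub>i\<^sub>k \<delta>\<^sub>j\<^sub>l - \<delta>\<^sub>i\<^sub>l \<delta>\<^sub>j\<^sub>k) / 2\<close>. Hence \<open>\<Sum>\<^sub>Z Z\<^sup>2 = - (n - 1) / 2\<close>, which is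
  the eigenvalue \<open>\<lambda>\<close>, and with \<open>q = p x\<close> one gets
  \<open>\<kappa>(\<phi>\<^sub>a, \<phi>\<^sub>b) = ((q, q) (a, b) - (q, b) (a, q)) / 2 = - \<phi>\<^sub>a \<phi>\<^sub>b / 2\<close>, because \<open>(a, b) = 0\<close>.\<close>

section \<open>The derivative of the matrix exponential at 0\<close>

lemma linear_matrix_mult_left: "linear (\<lambda>M. (A :: real^'n^'m) ** (M :: real^'k^'n))"
  by (intro linearI) (simp_all add: matrix_add_ldistrib matrix_scalar_ac flip: scalar_matrix_assoc)

lemma linear_matrix_mult_right: "linear (\<lambda>M. (M :: real^'n^'m) ** (A :: real^'k^'n))"
  by (intro linearI) (simp_all add: vec_eq_iff matrix_matrix_mult_def distrib_right sum.distrib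
      sum_distrib_left mult.assoc)

text \<open>Left multiplication by \<open>A\<close> is bounded with some constant \<open>K\<close>,
  so the exponential series of \<open>K\<close>, scaled by the norm of \<open>mat 1\<close>, is a
  majorant.\<close>

lemma summable_norm_mat_exp:
  fixes A :: "real^'n^'n"
  shows "summable (\<lambda>k. norm ((1 / fact k) *\<^sub>R ((\<lambda>M. A ** M) ^^ k) (mat 1)))"
proof -
  have "bounded_linear (\<lambda>M. A ** (M :: real^'n^'n))"
    using linear_matrix_mult_left linear_conv_bounded_linear by blast
  then obtain K where K: "K \<ge> 0" "\<And>M. norm (A ** (M :: real^'n^'n)) \<le> norm M * K"
    using bounded_linear.nonneg_bounded by blast
  have pow: "norm (((\<lambda>M. A ** M) ^^ k) (mat 1)) \<le> norm (mat 1 :: real^'n^'n) * K ^ k" for k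
  proof (induction k)
    case (Suc k)
    have "norm (((\<lambda>M. A ** M) ^^ Suc k) (mat 1)) \<le> norm (((\<lambda>M. A ** M) ^^ k) (mat 1)) * K"
      by (simp add: K)
    also have "\<dots> \<le> norm (mat 1 :: real^'n^'n) * K ^ k * K"
      using Suc K(1) by (rule mult_right_mono)
    finally show ?case by (simp add: mult_ac)
  qed simp
  have "summable (\<lambda>k. norm (mat 1 :: real^'n^'n) * (inverse (fact k) * K ^ k))"
    by (intro summable_mult summable_exp)
  then show ?thesis
  proof (rule summable_comparison_test')
    fix k :: nat
    show "norm (norm ((1 / fact k) *\<^sub>R ((\<lambda>M. A ** M) ^^ k) (mat 1)))
        \<le> norm (mat 1 :: real^'n^'n) * (inverse (fact k) * K ^ k)"
      using pow[of k] by (simp add: field_simps)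
  qed
qed

lemma funpow_scaleR_matrix_mult:
  fixes A :: "real^'n^'n"
  shows "((\<lambda>M. (t *\<^sub>R A) ** M) ^^ k) (mat 1) = t ^ k *\<^sub>R ((\<lambda>M. A ** M) ^^ k) (mat 1)"
proof (induction k)
  case (Suc k)
  have "((\<lambda>M. (t *\<^sub>R A) ** M) ^^ Suc k) (mat 1) = (t *\<^sub>R A) ** (t ^ k *\<^sub>R ((\<lambda>M. A ** M) ^^ k) (mat 1))"
    by (simp flip: Suc)
  also have "\<dots> = t ^ Suc k *\<^sub>R (A ** ((\<lambda>M. A ** M) ^^ k) (mat 1))"
    by (simp add: matrix_scalar_ac flip: scalar_matrix_assoc)
  finally show ?case by simp
qed simp

text \<open>Paired with a fixed \<open>b\<close>, the curve becomes a real power series in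
  \<open>t\<close> that converges everywhere, so it can be differentiated term by term.\<close>

lemma mat_exp_has_vector_derivative:
  fixes Z :: "real^'n^'n"
  shows "((\<lambda>t. mat_exp (t *\<^sub>R Z)) has_vector_derivative Z) (at 0)"
proof -
  have "((\<lambda>t. mat_exp (t *\<^sub>R Z) \<bullet> b) has_field_derivative Z \<bullet> b) (at 0)" for b
  proof -
    define c where "c = (\<lambda>k. (1 / fact k) * (((\<lambda>M. Z ** M) ^^ k) (mat 1) \<bullet> b))"
    have nth_term: "((1 / fact k) *\<^sub>R ((\<lambda>M. (t *\<^sub>R Z) ** M) ^^ k) (mat 1)) \<bullet> b = c k * t ^ k" for k t
      by (simp add: c_def funpow_scaleR_matrix_mult)
    have summ: "summable (\<lambda>k. (1 / fact k) *\<^sub>R ((\<lambda>M. (t *\<^sub>R Z) ** M) ^^ k) (mat 1))" for t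
      using summable_norm_mat_exp by (rule summable_norm_cancel)
    have "(\<lambda>k. c k * t ^ k) sums (mat_exp (t *\<^sub>R Z) \<bullet> b)" for t
      using bounded_linear.sums[OF bounded_linear_inner_left[of b] summable_sums[OF summ[of t]]]
      unfolding nth_term mat_exp_def .
    then have "summable (\<lambda>k. c k * t ^ k)" "mat_exp (t *\<^sub>R Z) \<bullet> b = (\<Sum>k. c k * t ^ k)" for t
      by (auto simp: sums_iff)
    then have "((\<lambda>t. mat_exp (t *\<^sub>R Z) \<bullet> b) has_field_derivative (\<Sum>k. diffs c k * 0 ^ k)) (at 0)"
      using termdiffs_strong_converges_everywhere[of c 0] by simp
    also have "(\<Sum>k. diffs c k * 0 ^ k) = Z \<bullet> b"
      \<comment> \<open>At 0 only the constant term of \<open>diffs c\<close> survives, namely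
        \<open>c 1\<close>.\<close>
      unfolding powser_zero by (simp add: diffs_def c_def)
    finally show ?thesis .
  qed
  then show ?thesis
    unfolding has_vector_derivative_def
    by (subst has_derivative_componentwise_within) (simp add: has_field_derivative_def mult_commute_abs)
qed

section \<open>Left-invariant derivatives of linear functions\<close>

lemma linear_curve_has_vector_derivative:
  fixes L :: "real^'n^'n \<Rightarrow> complex"
  assumes "linear L"
  shows "((\<lambda>t. L (x ** mat_exp (t *\<^sub>R Z))) has_vector_derivative L (x ** Z)) (at 0)"
proof -
  have "linear (\<lambda>M. L (x ** M))"
    using linear_compose[OF linear_matrix_mult_left assms] by (simp add: o_def)
  then have "bounded_linear (\<lambda>M. L (x ** M))"
    by (simp add: linear_conv_bounded_linear)
  from bounded_linear.has_vector_derivative[OF this mat_exp_has_vector_derivative]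
  show ?thesis .
qed

lemma lie_deriv_linear: "linear L \<Longrightarrow> lie_deriv Z L = (\<lambda>x. L (x ** Z))"
  unfolding lie_deriv_def
  by (intro ext vector_derivative_at linear_curve_has_vector_derivative)

lemma linear_lie_deriv: "linear L \<Longrightarrow> linear (lie_deriv Z L)"
  using linear_compose[OF linear_matrix_mult_right, of L Z]
  by (simp add: lie_deriv_linear o_def)

text \<open>Linear functions are continuous and closed under \<open>lie_deriv\<close>, so the
  induction on the order runs over all linear \<open>L\<close> at once.\<close>

lemma SO_smooth_linear:
  assumes "linear L"
  shows "SO_smooth L"
proof -
  have "SO_Ck k L" for k
    using assms
  proof (induction k arbitrary: L)
    case (Suc k)
    then show ?case
      by (auto simp: linear_continuous_on linear_conv_bounded_linear[symmetric] linear_lie_deriv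
          intro!: differentiableI_vector linear_curve_has_vector_derivative)
  qed (simp add: linear_continuous_on linear_conv_bounded_linear[symmetric])
  then show ?thesis by (simp add: SO_smooth_def)
qed

section \<open>Orthonormal bases of so(n)\<close>

lemma so_nth_swap:
  assumes "Z \<in> so"
  shows "Z $ j $ i = - (Z $ i $ j)"
proof -
  have "transpose Z $ i $ j = (- Z) $ i $ j"
    using assms by (simp only: so_def mem_Collect_eq)
  then show ?thesis
    by (simp add: transpose_def)
qed

lemma so_orthonormal_basis_expand:
  assumes "so_orthonormal_basis B" and "x \<in> so"
  shows "(\<Sum>Z\<in>B. (x \<bullet> Z) *\<^sub>R Z) = x"
proof (rule orthonormal_basis_expand)
  show orth: "pairwise orthogonal B"
    using assms(1)
    by (simp add: so_orthonormal_basis_def so_metric_eq_inner orthogonal_def pairwise_def)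
  show "finite B" by (rule pairwise_orthogonal_imp_finite[OF orth])
qed (use assms in \<open>auto simp: so_orthonormal_basis_def so_metric_eq_inner norm_eq_1\<close>)

lemma so_orthonormal_basis_sum:
  fixes B :: "(real^'n^'n) set"
  assumes "so_orthonormal_basis B"
  shows "(\<Sum>Z\<in>B. Z $ i $ j * Z $ k $ l) =
    ((if i = k \<and> j = l then 1 else 0) - (if i = l \<and> j = k then 1 else 0)) / 2"
proof -
  \<comment> \<open>The orthogonal projection to \<open>so\<close> of the matrix unit at position
    (k, l). By skew-symmetry its inner product with \<open>Z\<close> is the entry
    \<open>Z $ k $ l\<close>, so the sum is an entry of the expansion of \<open>W\<close> in
    \<open>B\<close>.\<close>
  define W :: "real^'n^'n" where "W = (1/2) *\<^sub>R (axis k (axis l 1) - axis l (axis k 1))"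
  have axis_nth: "axis a (axis b 1) $ i $ j = (if i = a \<and> j = b then 1 else (0 :: real))" for a b
    by (simp add: axis_def)
  have "W \<in> so"
    by (auto simp: W_def so_def transpose_def vec_eq_iff axis_def)
  have "W \<bullet> Z = Z $ k $ l" if "Z \<in> B" for Z
    using so_nth_swap[of Z k l] that assms
    by (auto simp: W_def inner_diff_left inner_axis' so_orthonormal_basis_def)
  then have "(\<Sum>Z\<in>B. Z $ i $ j * Z $ k $ l) = (\<Sum>Z\<in>B. (W \<bullet> Z) *\<^sub>R Z) $ i $ j"
    by (simp add: mult.commute)
  also have "\<dots> = W $ i $ j"
    by (simp add: so_orthonormal_basis_expand[OF assms \<open>W \<in> so\<close>])
  also have "\<dots> = (axis k (axis l 1) $ i $ j - axis l (axis k 1) $ i $ j) / 2"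
    by (simp add: W_def)
  also have "\<dots> = ((if i = k \<and> j = l then 1 else 0) - (if i = l \<and> j = k then 1 else 0)) / 2"
    by (simp only: axis_nth)
  finally show ?thesis .
qed

lemma so_orthonormal_basis_sum_square:
  fixes B :: "(real^'n^'n) set"
  assumes "so_orthonormal_basis B"
  shows "(\<Sum>Z\<in>B. Z ** Z) = (- (real CARD('n) - 1) / 2) *\<^sub>R mat 1"
proof -
  have "(\<Sum>Z\<in>B. Z ** Z) $ i $ j = (if i = j then - (real CARD('n) - 1) / 2 else 0)" for i j
  proof -
    have "(\<Sum>Z\<in>B. Z ** Z) $ i $ j = (\<Sum>k\<in>UNIV. \<Sum>Z\<in>B. Z $ i $ k * Z $ k $ j)"
      by (simp add: matrix_matrix_mult_def) (rule sum.swap)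
    \<comment> \<open>The first term contributes once, the second for each of the n values of
      \<open>k\<close>; hence the factor (1 - n) / 2 on the diagonal.\<close>
    also have "\<dots> = (\<Sum>k\<in>UNIV. (if k = i then if i = j then 1/2 else 0 else 0) - (if i = j then 1/2 else 0))"
    proof (rule sum.cong[OF refl])
      show "(\<Sum>Z\<in>B. Z $ i $ k * Z $ k $ j) =
          (if k = i then if i = j then 1/2 else 0 else 0) - (if i = j then 1/2 else 0)" for k
        unfolding so_orthonormal_basis_sum[OF assms] by (cases "i = j"; cases "k = i") simp_all
    qed
    also have "\<dots> = (if i = j then - (real CARD('n) - 1) / 2 else 0)"
      by (simp add: sum_subtractf field_simps)
    finally show ?thesis .
  qed
  then show ?thesis
    by (simp add: vec_eq_iff mat_def)
qed

section \<open>The operators \<open>tau\<close> and \<open>kappa\<close> on the functions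
  \<open>phi p a\<close>\<close>

lemma phi_eq_cbilin: "phi p a x = cbilin (\<chi> k. \<Sum>i\<in>UNIV. p $ i * of_real (x $ i $ k)) a"
proof -
  have "phi p a x = (\<Sum>i\<in>UNIV. \<Sum>k\<in>UNIV. p $ i * of_real (x $ i $ k) * a $ k)"
    by (simp add: phi_def trace_def matrix_matrix_mult_def transpose_def columnvector_def
        rowvector_def map_matrix_def mult_ac)
  also have "\<dots> = (\<Sum>k\<in>UNIV. \<Sum>i\<in>UNIV. p $ i * of_real (x $ i $ k) * a $ k)"
    by (rule sum.swap)
  finally show ?thesis
    by (simp add: cbilin_def sum_distrib_right)
qed

lemma linear_phi: "linear (phi p a)"
proof (rule linearI)
  show "phi p a (x + y) = phi p a x + phi p a y" for x y
    by (simp add: phi_eq_cbilin cbilin_def distrib_left distrib_right sum.distrib)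
  show "phi p a (r *\<^sub>R x) = r *\<^sub>R phi p a x" for r x
    by (simp add: phi_eq_cbilin cbilin_def scaleR_conv_of_real[where 'a = complex]
        sum_distrib_left sum_distrib_right mult_ac)
qed

lemma phi_matrix_mult:
  fixes x Z :: "real^'n^'n" and p a :: "complex^'n"
  defines "q \<equiv> \<chi> k. \<Sum>i\<in>UNIV. p $ i * of_real (x $ i $ k)"
  shows "phi p a (x ** Z) = (\<Sum>k\<in>UNIV. \<Sum>j\<in>UNIV. q $ k * a $ j * of_real (Z $ k $ j))"
proof -
  have "(\<Sum>i\<in>UNIV. p $ i * of_real ((x ** Z) $ i $ j)) = (\<Sum>k\<in>UNIV. q $ k * of_real (Z $ k $ j))" for j
    by (simp add: q_def matrix_matrix_mult_def sum_distrib_left sum_distrib_right mult.assoc)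
      (rule sum.swap)
  then have "phi p a (x ** Z) = (\<Sum>j\<in>UNIV. \<Sum>k\<in>UNIV. q $ k * a $ j * of_real (Z $ k $ j))"
    by (simp add: phi_eq_cbilin cbilin_def sum_distrib_left mult_ac)
  then show ?thesis
    by (subst sum.swap)
qed

text \<open>The first delta product pairs \<open>q\<close> with \<open>r\<close> and
  \<open>a\<close> with \<open>b\<close>, the second pairs \<open>q\<close> with \<open>b\<close>
  and \<open>a\<close> with \<open>r\<close>.\<close>

lemma sum_skew_delta:
  fixes q r a b :: "complex^'n"
  shows "(\<Sum>i\<in>UNIV. \<Sum>j\<in>UNIV. \<Sum>k\<in>UNIV. \<Sum>l\<in>UNIV. q $ i * a $ j * (r $ k * b $ l) *
      of_real (((if i = k \<and> j = l then 1 else 0) - (if i = l \<and> j = k then 1 else 0)) / 2)) =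
    (cbilin q r * cbilin a b - cbilin q b * cbilin a r) / 2"
proof -
  have "(\<Sum>k\<in>UNIV. \<Sum>l\<in>UNIV. q $ i * a $ j * (r $ k * b $ l) *
      of_real (((if i = k \<and> j = l then 1 else 0) - (if i = l \<and> j = k then 1 else 0)) / 2)) =
      (q $ i * r $ i * (a $ j * b $ j) - q $ i * b $ i * (a $ j * r $ j)) / 2" for i j
  proof -
    have "(\<Sum>k\<in>UNIV. \<Sum>l\<in>UNIV. q $ i * a $ j * (r $ k * b $ l) *
        of_real (((if i = k \<and> j = l then 1 else 0) - (if i = l \<and> j = k then 1 else 0)) / 2)) =
      (\<Sum>k\<in>UNIV. \<Sum>l\<in>UNIV. (if k = i then if l = j then q $ i * a $ j * (r $ i * b $ j) / 2 else 0 else 0)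
        - (if k = j then if l = i then q $ i * a $ j * (r $ j * b $ i) / 2 else 0 else 0))"
      by (intro sum.cong) auto
    also have "\<dots> = q $ i * a $ j * (r $ i * b $ j) / 2 - q $ i * a $ j * (r $ j * b $ i) / 2"
      by (simp add: sum_subtractf if_distrib[of "sum _"] sum.If_cases)
    finally show ?thesis
      by (simp add: field_simps)
  qed
  then show ?thesis
    by (simp add: cbilin_def sum_product sum_subtractf flip: sum_divide_distrib)
qed

text \<open>Differentiating twice along \<open>Z\<close> multiplies the argument by
  \<open>Z ** Z\<close> on the right; linearity moves the sum over \<open>B\<close> inside.\<close>

lemma tau_phi:
  fixes B :: "(real^'n^'n) set"
  assumes "so_orthonormal_basis B"
  shows "tau B (phi p a) x = of_real (- (real CARD('n) - 1) / 2) * phi p a x"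
proof -
  have "tau B (phi p a) x = (\<Sum>Z\<in>B. phi p a (x ** (Z ** Z)))"
    unfolding tau_def
    by (subst lie_deriv_linear[OF linear_lie_deriv[OF linear_phi]])
      (simp add: lie_deriv_linear[OF linear_phi] matrix_mul_assoc)
  also have "\<dots> = phi p a (x ** (\<Sum>Z\<in>B. Z ** Z))"
    by (simp add: linear_sum[OF linear_phi] linear_sum[OF linear_matrix_mult_left])
  also have "\<dots> = of_real (- (real CARD('n) - 1) / 2) * phi p a x"
    unfolding so_orthonormal_basis_sum_square[OF assms]
    by (simp only: linear_scale[OF linear_matrix_mult_left] matrix_mul_rid
        linear_scale[OF linear_phi] scaleR_conv_of_real[where 'a = complex])
  finally show ?thesis .
qed

lemma kappa_phi:
  fixes B :: "(real^'n^'n) set" and p a b :: "complex^'n"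
  assumes "so_orthonormal_basis B" and "cbilin a b = 0"
  shows "kappa B (phi p a) (phi p b) x = - (1/2) * phi p a x * phi p b x"
proof -
  define q where "q = (\<chi> k. \<Sum>i\<in>UNIV. p $ i * of_real (x $ i $ k))"
  have "kappa B (phi p a) (phi p b) x =
      (\<Sum>Z\<in>B. \<Sum>i\<in>UNIV. \<Sum>j\<in>UNIV. \<Sum>k\<in>UNIV. \<Sum>l\<in>UNIV.
        q $ i * a $ j * (q $ k * b $ l) * of_real (Z $ i $ j * Z $ k $ l))"
    unfolding kappa_def lie_deriv_linear[OF linear_phi] phi_matrix_mult q_def[symmetric]
      sum_distrib_right
    unfolding sum_distrib_left by (simp add: mult_ac)
  also have "\<dots> = (\<Sum>i\<in>UNIV. \<Sum>j\<in>UNIV. \<Sum>k\<in>UNIV. \<Sum>l\<in>UNIV.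
      q $ i * a $ j * (q $ k * b $ l) * of_real (\<Sum>Z\<in>B. Z $ i $ j * Z $ k $ l))"
    \<comment> \<open>Instantiating an index set with \<open>B\<close> orients the swap, so that the
      sum over \<open>B\<close> ends at the same place on both sides.\<close>
    unfolding of_real_sum sum_distrib_left by (simp only: sum.swap[of _ _ B])
  also have "\<dots> = (cbilin q q * cbilin a b - cbilin q b * cbilin a q) / 2"
    unfolding so_orthonormal_basis_sum[OF assms(1)] by (rule sum_skew_delta)
  \<comment> \<open>Isotropy removes the term with \<open>cbilin a b\<close>; by symmetry of
    \<open>cbilin\<close> the other two factors are \<open>phi p b x\<close> and
    \<open>phi p a x\<close>.\<close>
  also have "\<dots> = - (1/2) * phi p a x * phi p b x"
    using assms(2) by (simp add: phi_eq_cbilin q_def cbilin_def mult_ac)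
  finally show ?thesis .
qed

theorem theorem4p2:
  fixes V :: "(complex^'n) set" and p :: "complex^'n"
  assumes "maximal_isotropic V" and "p \<noteq> 0"
  shows "SO_eigenfamily (eigenfamily_set V p)"
proof -
  have "cbilin a b = 0" if "a \<in> V" "b \<in> V" for a b
    using assms(1) that by (simp add: maximal_isotropic_def isotropic_def)
  \<comment> \<open>Both constants depend on n alone, so they serve every \<open>B\<close> and every
    pair of functions.\<close>
  then have "tau B \<phi> x = of_real (- (real CARD('n) - 1) / 2) * \<phi> x \<and>
      kappa B \<phi> \<psi> x = - (1/2) * \<phi> x * \<psi> x"
    if "so_orthonormal_basis B" "\<phi> \<in> eigenfamily_set V p" "\<psi> \<in> eigenfamily_set V p" for B \<phi> \<psi> x
    using that tau_phi[of B] kappa_phi[of B] unfolding eigenfamily_set_def by blast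
  moreover have "SO_smooth \<phi>" if "\<phi> \<in> eigenfamily_set V p" for \<phi>
    using that SO_smooth_linear[OF linear_phi] unfolding eigenfamily_set_def by blast
  ultimately show ?thesis
    unfolding SO_eigenfamily_def by blast
qed

end
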